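(* Let $\mathcal{M}$ be a finite unitary magma and let $\mathcal{A}$ be an associative algebra over $\mathbb{K}$ with product $\odot$, together with linear maps $\omega_x:\mathcal{A}\to\mathcal{A}$, $x\in\mathcal{M}$, such that $\omega_{1_\mathcal{M}}=\mathrm{Id}_\mathcal{A}$ and $\omega_x\circ\omega_y=\omega_{x\star y}$ for all $x,y\in\mathcal{M}$. Then $\mathcal{A}$ is an $\mathrm{NC}\mathcal{M}$-algebra in which each $\mathcal{M}$-triangle $\mathfrak{p}$ (with base label $\mathfrak{p}_0$, first edge label $\mathfrak{p}_1$, second edge label $\mathfrak{p}_2$) acts by the binary operation $a_1\otimes a_2\mapsto \omega_{\mathfrak{p}_0}\big(\omega_{\mathfrak{p}_1}(a_1)\odot\omega_{\mathfrak{p}_2}(a_2)\big)$.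
   Context: $\mathbb{K}$ is a field of characteristic zero. A unitary magma $\mathcal{M}$ is a set with a binary operation $\star$ and two-sided unit $1_\mathcal{M}$. For $n\ge1$, an $\mathcal{M}$-clique of arity $n$ labels each arc $(x,y)$, $1\le x<y\le n+1$, of a polygon with vertices $1,\dots,n+1$ by an element of $\mathcal{M}$; base $(1,n+1)$, edges $(i,i+1)$, other arcs diagonals; $\mathfrak{p}_0$ is the base label, $\mathfrak{p}_i$ the label of edge $(i,i+1)$; exactly one clique in arity 1 (the unit). Solid arc: label $\neq1_\mathcal{M}$; noncrossing: no two solid diagonals $(x,y),(x',y')$ with $x<x'<y<y'$ or $x'<x<y'<y$. The partial composition $\mathfrak{p}\circ_i\mathfrak{q}$ ($\mathfrak{p}$ of arity $n$, $\mathfrak{q}$ of arity $m$, $i\in[n]$) glues the base of $\mathfrak{q}$ onto the $i$th edge of $\mathfrak{p}$, keeping the labels of the arcs of $\mathfrak{p}$ (vertices $>i$ shifted by $m-1$) and of $\mathfrak{q}$ (vertices shifted by $i-1$), labeling the common arc $(i,i+m)$ by $\mathfrak{p}_i\star\mathfrak{q}_0$ and all other arcs by $1_\mathcal{M}$. $\mathrm{NC}\mathcal{M}$ is the operad spanned by noncrossing $\mathcal{M}$-cliques with this composition; it is generated by the $\mathcal{M}$-triangles (cliques of arity 2). An $\mathrm{NC}\mathcal{M}$-algebra is a vector space with a linear action $\mathrm{NC}\mathcal{M}(n)\otimes\mathcal{A}^{\otimes n}\to\mathcal{A}$ compatible with partial compositions in the usual way. *)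

theory Defs
  imports Complex_Main "HOL-Library.FuncSet" "HOL-Library.Poly_Mapping"
begin

section \<open>Unitary magmas and decorated cliques\<close>

locale unitary_magma =
  fixes star :: "'m \<Rightarrow> 'm \<Rightarrow> 'm" and e :: 'm
  assumes left_unit: "star e x = x"
    and right_unit: "star x e = x"

definition arcs :: "nat \<Rightarrow> (nat \<times> nat) set" where
  "arcs n = {(x, y). 1 \<le> x \<and> x < y \<and> y \<le> n + 1}"

definition diagonals :: "nat \<Rightarrow> (nat \<times> nat) set" where
  "diagonals n = {(x, y) \<in> arcs n. (x, y) \<noteq> (1, n + 1) \<and> y \<noteq> x + 1}"

text \<open>
  A clique of arity \<open>n\<close> is a labeling of \<open>arcs n\<close>, represented by an extensional function.
  There are no cliques of arity 0. In arity 1 the only arc is required to carry the unit \<open>e\<close>,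
  so that there is exactly one clique.
\<close>

type_synonym 'm clique = "nat \<times> nat \<Rightarrow> 'm"

definition cliques :: "'m \<Rightarrow> nat \<Rightarrow> 'm clique set" where
  "cliques e n = {p \<in> arcs n \<rightarrow>\<^sub>E UNIV. 1 \<le> n \<and> (n = 1 \<longrightarrow> p (1, 2) = e)}"

definition base_label :: "nat \<Rightarrow> 'm clique \<Rightarrow> 'm" where
  "base_label n p = p (1, n + 1)"

definition edge_label :: "'m clique \<Rightarrow> nat \<Rightarrow> 'm" where
  "edge_label p i = p (i, i + 1)"

definition crossing :: "nat \<times> nat \<Rightarrow> nat \<times> nat \<Rightarrow> bool" where
  "crossing = (\<lambda>(x, y) (x', y'). (x < x' \<and> x' < y \<and> y < y') \<or> (x' < x \<and> x < y' \<and> y' < y))"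

definition noncrossing :: "'m \<Rightarrow> nat \<Rightarrow> 'm clique \<Rightarrow> bool" where
  "noncrossing e n p \<longleftrightarrow>
     \<not> (\<exists>a \<in> diagonals n. \<exists>b \<in> diagonals n. p a \<noteq> e \<and> p b \<noteq> e \<and> crossing a b)"

definition nc_cliques :: "'m \<Rightarrow> nat \<Rightarrow> 'm clique set" where
  "nc_cliques e n = {p \<in> cliques e n. noncrossing e n p}"

text \<open>
  \<open>clique_comp star e n m i p q\<close> is the partial composition of \<open>p\<close> (of arity \<open>n\<close>) and \<open>q\<close>
  (of arity \<open>m\<close>) at \<open>i\<close>. A vertex \<open>v\<close> of the composite comes from \<open>p\<close> iff \<open>v \<le> i\<close> or
  \<open>i + m \<le> v\<close>, in which case it is the vertex \<open>v\<close> resp. \<open>v + 1 - m\<close> of \<open>p\<close>; it comes from \<open>q\<close>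
  iff \<open>i \<le> v \<le> i + m\<close>, in which case it is the vertex \<open>v + 1 - i\<close> of \<open>q\<close>.
\<close>

definition clique_comp ::
    "('m \<Rightarrow> 'm \<Rightarrow> 'm) \<Rightarrow> 'm \<Rightarrow> nat \<Rightarrow> nat \<Rightarrow> nat \<Rightarrow> 'm clique \<Rightarrow> 'm clique \<Rightarrow> 'm clique" where
  "clique_comp star e n m i p q =
     (let in_p = (\<lambda>v. v \<le> i \<or> i + m \<le> v);
          to_p = (\<lambda>v. if v \<le> i then v else v + 1 - m);
          in_q = (\<lambda>v. i \<le> v \<and> v \<le> i + m);
          to_q = (\<lambda>v. v + 1 - i)
      in (\<lambda>(x, y) \<in> arcs (n + m - 1).
            if (x, y) = (i, i + m) then star (edge_label p i) (base_label m q)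
            else if in_p x \<and> in_p y then p (to_p x, to_p y)
            else if in_q x \<and> in_q y then q (to_q x, to_q y)
            else e))"


section \<open>The linear operad of noncrossing cliques\<close>

text \<open>Formal linear combinations of cliques are finitely supported functions.\<close>

abbreviation smult_pm :: "'k::field \<Rightarrow> ('b \<Rightarrow>\<^sub>0 'k) \<Rightarrow> ('b \<Rightarrow>\<^sub>0 'k)" where
  "smult_pm c \<equiv> Poly_Mapping.map ((*) c)"

definition NC :: "'m \<Rightarrow> nat \<Rightarrow> ('m clique \<Rightarrow>\<^sub>0 'k::field) set" where
  "NC e n = {f. Poly_Mapping.keys f \<subseteq> nc_cliques e n}"

definition NC_comp ::
    "('m \<Rightarrow> 'm \<Rightarrow> 'm) \<Rightarrow> 'm \<Rightarrow> nat \<Rightarrow> nat \<Rightarrow> nat \<Rightarrow>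
     ('m clique \<Rightarrow>\<^sub>0 'k::field) \<Rightarrow> ('m clique \<Rightarrow>\<^sub>0 'k) \<Rightarrow> ('m clique \<Rightarrow>\<^sub>0 'k)" where
  "NC_comp star e n m i f g =
     (\<Sum>p \<in> Poly_Mapping.keys f. \<Sum>q \<in> Poly_Mapping.keys g.
        Poly_Mapping.single (clique_comp star e n m i p q)
          (Poly_Mapping.lookup f p * Poly_Mapping.lookup g q))"

definition NC_unit :: "'m \<Rightarrow> ('m clique \<Rightarrow>\<^sub>0 'k::field)" where
  "NC_unit e = Poly_Mapping.single (\<lambda>a \<in> arcs 1. e) 1"


section \<open>Algebras over a nonsymmetric operad\<close>

text \<open>
  The operad is given by its components \<open>Op n\<close>, \<open>n \<ge> 1\<close>, their scalar multiplication \<open>oscale\<close>,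
  the partial compositions \<open>comp n m i : Op n \<times> Op m \<rightarrow> Op (n + m - 1)\<close> for \<open>1 \<le> i \<le> n\<close>, and its
  unit. A linear action \<open>Op n \<otimes> A\<^sup>\<otimes>\<^sup>n \<rightarrow> A\<close> is given as a multilinear map, the elements of
  \<open>A\<^sup>n\<close> being the lists of length \<open>n\<close>; \<open>act n f xs\<close> is only meaningful for \<open>f \<in> Op n\<close> and
  \<open>length xs = n\<close>.
\<close>

locale operad_algebra = vector_space scale
  for scale :: "'k::field \<Rightarrow> 'a::ab_group_add \<Rightarrow> 'a" +
  fixes Op :: "nat \<Rightarrow> 'o::ab_group_add set"
    and oscale :: "'k \<Rightarrow> 'o \<Rightarrow> 'o"
    and comp :: "nat \<Rightarrow> nat \<Rightarrow> nat \<Rightarrow> 'o \<Rightarrow> 'o \<Rightarrow> 'o"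
    and unit :: 'o
    and act :: "nat \<Rightarrow> 'o \<Rightarrow> 'a list \<Rightarrow> 'a"
  assumes act_add: "\<lbrakk>1 \<le> n; f \<in> Op n; g \<in> Op n; length xs = n\<rbrakk>
      \<Longrightarrow> act n (f + g) xs = act n f xs + act n g xs"
    and act_scale: "\<lbrakk>1 \<le> n; f \<in> Op n; length xs = n\<rbrakk>
      \<Longrightarrow> act n (oscale c f) xs = scale c (act n f xs)"
    and act_multilinear: "\<lbrakk>1 \<le> n; f \<in> Op n; length xs = n; k < n\<rbrakk>
      \<Longrightarrow> Vector_Spaces.linear scale scale (\<lambda>a. act n f (xs[k := a]))"
    and act_unit: "act 1 unit [a] = a"
    and act_comp: "\<lbrakk>1 \<le> n; 1 \<le> m; 1 \<le> i; i \<le> n; f \<in> Op n; g \<in> Op m;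
        length us = i - 1; length vs = m; length ws = n - i\<rbrakk>
      \<Longrightarrow> act (n + m - 1) (comp n m i f g) (us @ vs @ ws) = act n f (us @ act m g vs # ws)"

definition NC_algebra ::
    "('m \<Rightarrow> 'm \<Rightarrow> 'm) \<Rightarrow> 'm \<Rightarrow> ('k::field \<Rightarrow> 'a::ab_group_add \<Rightarrow> 'a) \<Rightarrow>
     (nat \<Rightarrow> ('m clique \<Rightarrow>\<^sub>0 'k) \<Rightarrow> 'a list \<Rightarrow> 'a) \<Rightarrow> bool" where
  "NC_algebra star e scale act \<longleftrightarrow>
     operad_algebra scale (NC e) smult_pm (NC_comp star e) (NC_unit e) act"


section \<open>Associative algebras\<close>

text \<open>Associative algebras are not required to have a unit.\<close>

locale associative_algebra = vector_space scale
  for scale :: "'k::field \<Rightarrow> 'a::ab_group_add \<Rightarrow> 'a" +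
  fixes mul :: "'a \<Rightarrow> 'a \<Rightarrow> 'a"
  assumes mul_linear_left: "Vector_Spaces.linear scale scale (\<lambda>a. mul a b)"
    and mul_linear_right: "Vector_Spaces.linear scale scale (\<lambda>b. mul a b)"
    and mul_assoc: "mul (mul a b) c = mul a (mul b c)"

end

theory Submission
  imports Defs
begin

text \<open>
  The solid arcs of a noncrossing clique bracket the word \<open>a\<^sub>1 \<dots> a\<^sub>n\<close>: an arc \<open>(x, y)\<close> stands for
  \<open>\<omega>\<close> of its label, applied to a product of the values of two arcs \<open>(x, z)\<close> and \<open>(z, y)\<close>, where
  no solid arc inside \<open>(x, y)\<close> passes over \<open>z\<close>. Noncrossing cliques always have such a \<open>z\<close>, and
  by associativity of the product all choices of \<open>z\<close> give the same value. A clique acts by the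
  value of its base. In a partial composition, split points of either factor remain split points,
  and the common arc contributes \<open>\<omega>\<close> of \<open>p\<^sub>i \<star> q\<^sub>0\<close>, that is, \<open>\<omega>\<close> of \<open>p\<^sub>i\<close> after \<open>\<omega>\<close> of \<open>q\<^sub>0\<close>.
\<close>

section \<open>Split points of arcs\<close>

definition split_point :: "'m \<Rightarrow> 'm clique \<Rightarrow> nat \<Rightarrow> nat \<Rightarrow> nat \<Rightarrow> bool" where
  "split_point e p x y z \<longleftrightarrow> x < z \<and> z < y \<and>
     (\<forall>u v. x \<le> u \<and> u < z \<and> z < v \<and> v \<le> y \<and> (u, v) \<noteq> (x, y) \<longrightarrow> p (u, v) = e)"

lemma split_pointD:
  assumes "split_point e p x y z" "x \<le> u" "u < z" "z < v" "v \<le> y" "(u, v) \<noteq> (x, y)"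
  shows "p (u, v) = e"
  using assms unfolding split_point_def by blast

lemma split_point_between:
  assumes "split_point e p x y z"
  shows "x < z" "z < y"
  using assms by (simp_all add: split_point_def)

text \<open>Arcs within \<open>(x', y')\<close> lie within \<open>(x, y)\<close>; the exempt arc
  \<open>(x, y)\<close> is among them only if \<open>(x', y') = (x, y)\<close>, and then it is
  exempt again.\<close>

lemma split_point_subarc:
  assumes "split_point e p x y z" "x \<le> x'" "x' < z" "z < y'" "y' \<le> y"
  shows "split_point e p x' y' z"
  unfolding split_point_def
proof (intro conjI allI impI)
  fix u v assume "x' \<le> u \<and> u < z \<and> z < v \<and> v \<le> y' \<and> (u, v) \<noteq> (x', y')"
  then show "p (u, v) = e"
    using assms by (intro split_pointD[OF assms(1)]) auto
qed (use assms in auto)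

text \<open>Take as \<open>z\<close> the far end of the longest solid arc that starts at
  \<open>x\<close> and ends before \<open>y\<close>. Another solid arc over \<open>z\<close> would
  be a longer one from \<open>x\<close>, or would start further right and cross
  \<open>(x, z)\<close>.\<close>

lemma noncrossing_split_point:
  assumes nc: "noncrossing e n p" and x: "1 \<le> x" and xy: "x + 1 < y" and y: "y \<le> n + 1"
  shows "\<exists>z. split_point e p x y z"
proof -
  define S where "S = {z. x < z \<and> z < y \<and> (z = x + 1 \<or> p (x, z) \<noteq> e)}"
  define z where "z = Max S"
  have fin: "finite S" unfolding S_def by (rule finite_subset[of _ "{..<y}"]) auto
  have "x + 1 \<in> S" using xy by (simp add: S_def)
  with fin have zS: "z \<in> S" unfolding z_def by (intro Max_in) auto
  have max: "w \<le> z" if "w \<in> S" for w using that fin by (simp add: z_def)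
  have "p (u, v) = e"
    if uv: "x \<le> u" "u < z" "z < v" "v \<le> y" "(u, v) \<noteq> (x, y)" for u v
  proof (rule ccontr)
    assume solid: "p (u, v) \<noteq> e"
    show False
    proof (cases "u = x")
      case True
      then have "v \<in> S" using uv solid zS by (auto simp: S_def)
      with max uv(3) show False by force
    next
      case False
      then have "x < u" using uv by simp
      \<comment> \<open>As \<open>u\<close> lies strictly between \<open>x\<close> and
        \<open>z\<close>, the vertex \<open>z\<close> is not \<open>x + 1\<close>; so
        \<open>(x, z)\<close> is solid and a diagonal.\<close>
      then have "p (x, z) \<noteq> e" and "x + 1 < z" using zS uv by (auto simp: S_def)
      moreover have "(x, z) \<in> diagonals n" "(u, v) \<in> diagonals n"
        using uv zS x y \<open>x < u\<close> \<open>x + 1 < z\<close> by (auto simp: diagonals_def arcs_def S_def)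
      moreover have "crossing (x, z) (u, v)"
        using \<open>x < u\<close> uv by (simp add: crossing_def)
      ultimately show False using nc solid unfolding noncrossing_def by blast
    qed
  qed
  moreover have "x < z" "z < y" using zS by (auto simp: S_def)
  ultimately have "split_point e p x y z" unfolding split_point_def by blast
  then show ?thesis ..
qed

section \<open>Values of arcs, independent of the split points chosen\<close>

locale magma_module = unitary_magma star e + associative_algebra scale mul
  for star :: "'m \<Rightarrow> 'm \<Rightarrow> 'm" and e :: 'm
    and scale :: "'k::field \<Rightarrow> 'a::ab_group_add \<Rightarrow> 'a"
    and mul :: "'a \<Rightarrow> 'a \<Rightarrow> 'a" +
  fixes \<omega> :: "'m \<Rightarrow> 'a \<Rightarrow> 'a"
  assumes omega_linear: "Vector_Spaces.linear scale scale (\<omega> x)"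
    and omega_unit: "\<omega> e a = a"
    and omega_star: "\<omega> (star x y) a = \<omega> x (\<omega> y a)"
begin

text \<open>The value of an arc before its own label is applied. \<open>SOME\<close> picks an
  arbitrary split point; \<open>inner_value_split\<close> shows that the choice is immaterial. The
  default \<open>a x\<close> is meant for the edge \<open>(x, x + 1)\<close>, which has no split
  point.\<close>

function inner_value :: "'m clique \<Rightarrow> (nat \<Rightarrow> 'a) \<Rightarrow> nat \<Rightarrow> nat \<Rightarrow> 'a" where
  "inner_value p a x y =
     (if \<exists>z. split_point e p x y z then
        let z = SOME z. split_point e p x y z in
          mul (\<omega> (p (x, z)) (inner_value p a x z)) (\<omega> (p (z, y)) (inner_value p a z y))
      else a x)"
  by pat_completeness auto
termination
proof (relation "Wellfounded.measure (\<lambda>(p, a, x, y). y - x)", goal_cases)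
  case (2 p a x y z)
  then have "split_point e p x y z" by (auto intro: someI_ex)
  then show ?case by (auto simp: split_point_def)
next
  case (3 p a x y z)
  then have "split_point e p x y z" by (auto intro: someI_ex)
  then show ?case by (auto simp: split_point_def)
qed simp

declare inner_value.simps [simp del]

definition arc_value :: "'m clique \<Rightarrow> (nat \<Rightarrow> 'a) \<Rightarrow> nat \<Rightarrow> nat \<Rightarrow> 'a" where
  "arc_value p a x y = \<omega> (p (x, y)) (inner_value p a x y)"

lemma inner_value_edge: "inner_value p a x (Suc x) = a x"
  by (subst inner_value.simps) (auto simp: split_point_def)

lemma arc_value_edge: "arc_value p a x (Suc x) = \<omega> (p (x, Suc x)) (a x)"
  by (simp add: arc_value_def inner_value_edge)

text \<open>For split points \<open>s < t\<close>, the arcs \<open>(s, y)\<close> and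
  \<open>(x, t)\<close> pass over \<open>t\<close> and \<open>s\<close> and so carry the unit.
  Splitting them at \<open>t\<close> and \<open>s\<close> by induction turns both products into the
  values of \<open>(x, s)\<close>, \<open>(s, t)\<close>, \<open>(t, y)\<close>, bracketed in two
  ways.\<close>

lemma inner_value_split:
  assumes "split_point e p x y z"
  shows "inner_value p a x y = mul (arc_value p a x z) (arc_value p a z y)"
  using assms
proof (induction "y - x" arbitrary: x y z rule: less_induct)
  case less
  define w where "w = (SOME w. split_point e p x y w)"
  have w: "split_point e p x y w" unfolding w_def using less.prems by (rule someI)
  have eq: "inner_value p a x y = mul (arc_value p a x w) (arc_value p a w y)"
    using less.prems by (subst inner_value.simps) (auto simp: w_def Let_def arc_value_def)
  have swap: "mul (arc_value p a x s) (arc_value p a s y) =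
      mul (arc_value p a x t) (arc_value p a t y)"
    if s: "split_point e p x y s" and t: "split_point e p x y t" and st: "s < t" for s t
  proof -
    note bounds = split_point_between[OF s] split_point_between[OF t]
    have "p (s, y) = e" using bounds st by (intro split_pointD[OF t]) auto
    moreover have "split_point e p s y t" using bounds st by (intro split_point_subarc[OF t]) auto
    ultimately have sy: "arc_value p a s y = mul (arc_value p a s t) (arc_value p a t y)"
      using less.hyps[of y s t] bounds by (simp add: arc_value_def omega_unit)
    have "p (x, t) = e" using bounds st by (intro split_pointD[OF s]) auto
    moreover have "split_point e p x t s" using bounds st by (intro split_point_subarc[OF s]) auto
    ultimately have xt: "arc_value p a x t = mul (arc_value p a x s) (arc_value p a s t)"
      using less.hyps[of t x s] bounds by (simp add: arc_value_def omega_unit)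
    show ?thesis unfolding sy xt by (simp add: mul_assoc)
  qed
  show ?case
  proof (cases z w rule: linorder_cases)
    case zw: less
    from swap[OF less.prems w zw] show ?thesis unfolding eq by (rule sym)
  next
    case equal
    with eq show ?thesis by simp
  next
    case greater
    from swap[OF w less.prems this] show ?thesis unfolding eq .
  qed
qed

section \<open>Values of arcs in a partial composition\<close>

text \<open>
  The edges of \<open>p\<close> in the range \<open>{X..Y}\<close> may be mapped to longer arcs of \<open>c\<close>, and the labels
  of \<open>(X, Y)\<close> and its image may differ: both freedoms are needed for partial composition.
\<close>

lemma inner_value_embed:
  assumes mono: "\<And>x y. X \<le> x \<Longrightarrow> x < y \<Longrightarrow> y \<le> Y \<Longrightarrow> \<phi> x < \<phi> y"
    and label: "\<And>x y. X \<le> x \<Longrightarrow> x + 1 < y \<Longrightarrow> y \<le> Y \<Longrightarrow> (x, y) \<noteq> (X, Y) \<Longrightarrow>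
      c (\<phi> x, \<phi> y) = p (x, y)"
    and edge: "\<And>x. X \<le> x \<Longrightarrow> x < Y \<Longrightarrow>
      arc_value c a (\<phi> x) (\<phi> (Suc x)) = arc_value p b x (Suc x)"
    and solid: "\<And>u v z. X < z \<Longrightarrow> z < Y \<Longrightarrow> \<phi> X \<le> u \<Longrightarrow> u < \<phi> z \<Longrightarrow> \<phi> z < v \<Longrightarrow> v \<le> \<phi> Y \<Longrightarrow>
      (u, v) \<noteq> (\<phi> X, \<phi> Y) \<Longrightarrow> c (u, v) \<noteq> e \<Longrightarrow> u \<in> \<phi> ` {X..Y} \<and> v \<in> \<phi> ` {X..Y}"
    and split: "\<And>x y. X \<le> x \<Longrightarrow> x + 1 < y \<Longrightarrow> y \<le> Y \<Longrightarrow> \<exists>z. split_point e p x y z"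
    and xy: "X \<le> x" "x + 1 < y" "y \<le> Y"
  shows "inner_value c a (\<phi> x) (\<phi> y) = inner_value p b x y"
  using xy
proof (induction "y - x" arbitrary: x y rule: less_induct)
  case less
  have less_iff: "\<phi> s < \<phi> t \<longleftrightarrow> s < t" if "s \<in> {X..Y}" "t \<in> {X..Y}" for s t
    using that mono[of s t] mono[of t s] by (cases s t rule: linorder_cases) auto
  obtain z where z: "split_point e p x y z" using split less.prems by blast
  note zb = split_point_between[OF z]
  have arc: "arc_value c a (\<phi> s) (\<phi> t) = arc_value p b s t"
    if st: "x \<le> s" "s < t" "t \<le> y" "(s, t) \<noteq> (x, y)" for s t
  proof (cases "t = Suc s")
    case True
    then show ?thesis using edge st less.prems by simp
  next
    case False
    then have "s + 1 < t" using st by simp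
    moreover have "t - s < y - x" using st by auto
    moreover have "(s, t) \<noteq> (X, Y)" using st less.prems by auto
    ultimately show ?thesis
      using less.hyps[of t s] label[of s t] st less.prems by (simp add: arc_value_def)
  qed
  \<comment> \<open>A solid arc of \<open>c\<close> over \<open>\<phi> z\<close> would come from a
    solid arc of \<open>p\<close> over \<open>z\<close>, so \<open>\<phi>\<close> preserves split
    points.\<close>
  have "split_point e c (\<phi> x) (\<phi> y) (\<phi> z)"
    unfolding split_point_def
  proof (intro conjI allI impI)
    show "\<phi> x < \<phi> z" "\<phi> z < \<phi> y" using zb less.prems by (auto intro: mono)
  next
    fix u v
    assume uv: "\<phi> x \<le> u \<and> u < \<phi> z \<and> \<phi> z < v \<and> v \<le> \<phi> y \<and> (u, v) \<noteq> (\<phi> x, \<phi> y)"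
    show "c (u, v) = e"
    proof (rule ccontr)
      assume c: "c (u, v) \<noteq> e"
      have "\<phi> X \<le> \<phi> x" "\<phi> y \<le> \<phi> Y"
        using less_iff[of x X] less_iff[of Y y] less.prems by force+
      then have "\<phi> X \<le> u" "v \<le> \<phi> Y" "(u, v) \<noteq> (\<phi> X, \<phi> Y)" using uv by auto
      then obtain s t where s: "u = \<phi> s" "s \<in> {X..Y}" and t: "v = \<phi> t" "t \<in> {X..Y}"
        using solid[of z u v] uv c zb less.prems by auto
      have "x \<le> s" "s < z" "z < t" "t \<le> y" "(s, t) \<noteq> (x, y)"
        using uv s t zb less.prems less_iff[of s x] less_iff[of s z] less_iff[of z t] less_iff[of y t]
        by force+
      moreover from this have "p (s, t) = e" by (intro split_pointD[OF z])
      moreover have "(s, t) \<noteq> (X, Y)" using uv s t \<open>(u, v) \<noteq> (\<phi> X, \<phi> Y)\<close> by auto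
      ultimately show False using label[of s t] c s t by auto
    qed
  qed
  then have "inner_value c a (\<phi> x) (\<phi> y) =
      mul (arc_value c a (\<phi> x) (\<phi> z)) (arc_value c a (\<phi> z) (\<phi> y))"
    by (rule inner_value_split)
  also have "\<dots> = mul (arc_value p b x z) (arc_value p b z y)"
    using zb by (simp add: arc)
  also have "\<dots> = inner_value p b x y" using z by (rule inner_value_split[symmetric])
  finally show ?case .
qed

text \<open>Inside the composite \<open>q\<close> is shifted by \<open>i - 1\<close>, and only its
  base is relabeled, which \<open>inner_value\<close> ignores.\<close>

lemma inner_value_comp_right:
  assumes "noncrossing e m q" and nm: "1 \<le> i" "i \<le> n" "1 \<le> m"
    and ab: "\<And>j. 1 \<le> j \<Longrightarrow> j \<le> m \<Longrightarrow> a (j + i - 1) = b j"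
  shows "inner_value (clique_comp star e n m i p q) a i (i + m) = inner_value q b 1 (m + 1)"
proof (cases "m = 1")
  \<comment> \<open>Here the base of \<open>q\<close> is also its only edge, so the edge itself is
    relabeled and the embedding does not apply.\<close>
  case True
  then show ?thesis using ab[of 1] by (simp add: inner_value_edge)
next
  case False
  let ?c = "clique_comp star e n m i p q"
  define \<phi> where "\<phi> x = x + i - 1" for x
  have lab: "?c (\<phi> x, \<phi> y) = q (x, y)" if "1 \<le> x" "x < y" "y \<le> m + 1" "(x, y) \<noteq> (1, m + 1)" for x y
    using that nm by (auto simp: clique_comp_def arcs_def \<phi>_def)
  have "inner_value ?c a (\<phi> 1) (\<phi> (m + 1)) = inner_value q b 1 (m + 1)"
  proof (rule inner_value_embed[where X = 1 and Y = "m + 1"])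
    fix x assume "1 \<le> x" "x < m + 1"
    then show "arc_value ?c a (\<phi> x) (\<phi> (Suc x)) = arc_value q b x (Suc x)"
      using lab[of x "Suc x"] ab[of x] False nm arc_value_edge[of ?c a "\<phi> x"]
      by (auto simp: \<phi>_def arc_value_edge Suc_diff_le)
  next
    fix u v z assume *: "\<phi> 1 \<le> u" "v \<le> \<phi> (m + 1)" "u < \<phi> z" "\<phi> z < v"
    have "w \<in> \<phi> ` {1..m + 1}" if "\<phi> 1 \<le> w" "w \<le> \<phi> (m + 1)" for w
      using that nm by (intro image_eqI[of _ _ "w + 1 - i"]) (auto simp: \<phi>_def)
    then show "u \<in> \<phi> ` {1..m + 1} \<and> v \<in> \<phi> ` {1..m + 1}" using * by simp
  qed (use False nm lab noncrossing_split_point[OF assms(1)] in \<open>auto simp: \<phi>_def\<close>)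
  then show ?thesis using nm by (simp add: \<phi>_def add.commute)
qed

text \<open>The common arc is labeled by the \<open>star\<close> of the two glued labels, and
  \<open>omega_star\<close> turns this into applying first the base label of \<open>q\<close>, then
  the edge label of \<open>p\<close>.\<close>

lemma arc_value_comp_common:
  assumes "noncrossing e m q" "1 \<le> i" "i \<le> n" "1 \<le> m"
    and "\<And>j. 1 \<le> j \<Longrightarrow> j \<le> m \<Longrightarrow> a (j + i - 1) = b j"
  shows "arc_value (clique_comp star e n m i p q) a i (i + m) =
    \<omega> (p (i, Suc i)) (arc_value q b 1 (m + 1))"
proof -
  have "clique_comp star e n m i p q (i, i + m) = star (p (i, Suc i)) (q (1, Suc m))"
    using assms by (auto simp: clique_comp_def arcs_def edge_label_def base_label_def)
  then show ?thesis
    using inner_value_comp_right[where a = a and b = b, OF assms] by (simp add: arc_value_def omega_star)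
qed

text \<open>The composite contains \<open>p\<close> with its edge \<open>i\<close> stretched to the
  common arc. Feeding the value of \<open>q\<close> to that edge through \<open>b\<close> makes the
  edge and the common arc agree, so \<open>inner_value_embed\<close> applies.\<close>

lemma arc_value_comp:
  assumes p: "p \<in> nc_cliques e n" and q: "q \<in> nc_cliques e m" and i: "1 \<le> i" "i \<le> n"
    and as: "\<And>j. 1 \<le> j \<Longrightarrow> j \<le> m \<Longrightarrow> a (j + i - 1) = a' j"
    and b1: "\<And>j. 1 \<le> j \<Longrightarrow> j < i \<Longrightarrow> b j = a j"
    and b2: "b i = arc_value q a' 1 (m + 1)"
    and b3: "\<And>j. i < j \<Longrightarrow> j \<le> n \<Longrightarrow> b j = a (j + m - 1)"
  shows "arc_value (clique_comp star e n m i p q) a 1 (n + m) = arc_value p b 1 (n + 1)"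
proof -
  let ?c = "clique_comp star e n m i p q"
  have m: "1 \<le> m" and ncp: "noncrossing e n p" and ncq: "noncrossing e m q"
    using p q by (auto simp: nc_cliques_def cliques_def)
  have common: "arc_value ?c a i (i + m) = arc_value p b i (Suc i)"
    using arc_value_comp_common[where p = p and a = a and b = a', OF ncq i m as] b2
    by (simp add: arc_value_edge)
  show ?thesis
  proof (cases "n = 1")
    \<comment> \<open>The base of \<open>p\<close> is its only edge and becomes the common
      arc.\<close>
    case True
    then have "i = 1" using i by simp
    then show ?thesis using common True by simp
  next
    case False
    define \<phi> where "\<phi> x = (if x \<le> i then x else x + m - 1)" for x
    have lab: "?c (\<phi> x, \<phi> y) = p (x, y)"
      if "1 \<le> x" "x < y" "y \<le> n + 1" "\<not> (x = i \<and> y = Suc i)" for x y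
      using that i m by (auto simp: clique_comp_def arcs_def \<phi>_def)
    have "inner_value ?c a (\<phi> 1) (\<phi> (n + 1)) = inner_value p b 1 (n + 1)"
    proof (rule inner_value_embed[where X = 1 and Y = "n + 1"])
      fix x assume x: "1 \<le> x" "x < n + 1"
      show "arc_value ?c a (\<phi> x) (\<phi> (Suc x)) = arc_value p b x (Suc x)"
      proof (cases x i rule: linorder_cases)
        case less
        then show ?thesis
          using lab[of x "Suc x"] x b1[of x] by (simp add: \<phi>_def arc_value_edge)
      next
        case equal
        then show ?thesis using common by (simp add: \<phi>_def add.commute)
      next
        case greater
        moreover from this have "\<phi> (Suc x) = Suc (\<phi> x)" using m by (simp add: \<phi>_def)
        ultimately show ?thesis
          using lab[of x "Suc x"] x b3[of x] arc_value_edge[of ?c a "\<phi> x"]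
          by (simp add: \<phi>_def arc_value_edge)
      qed
    next
      fix u v z
      assume *: "1 < z" "z < n + 1" "\<phi> 1 \<le> u" "u < \<phi> z" "\<phi> z < v" "v \<le> \<phi> (n + 1)" "?c (u, v) \<noteq> e"
      \<comment> \<open>No vertex of \<open>p\<close> lies strictly inside the glued
        \<open>q\<close>, so an arc over \<open>\<phi> z\<close> has an end outside
        \<open>q\<close>; being solid, it comes from \<open>p\<close>.\<close>
      have "\<phi> z \<le> i \<or> i + m \<le> \<phi> z" by (auto simp: \<phi>_def)
      then have pv: "(u \<le> i \<or> i + m \<le> u) \<and> (v \<le> i \<or> i + m \<le> v)"
        using * m i by (auto simp: clique_comp_def arcs_def \<phi>_def split: if_splits)
      have "w \<in> \<phi> ` {1..n + 1}" if "1 \<le> w" "w \<le> n + m" "w \<le> i \<or> i + m \<le> w" for w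
      proof (cases "w \<le> i")
        case True
        then show ?thesis using that i by (intro image_eqI[of _ _ w]) (auto simp: \<phi>_def)
      next
        case False
        then show ?thesis
          using that i m by (intro image_eqI[of _ _ "w + 1 - m"]) (auto simp: \<phi>_def)
      qed
      moreover have "1 \<le> u" "u \<le> n + m" "1 \<le> v" "v \<le> n + m"
        using * i by (auto simp: \<phi>_def)
      ultimately show "u \<in> \<phi> ` {1..n + 1} \<and> v \<in> \<phi> ` {1..n + 1}" using pv by blast
    qed (use False i m lab noncrossing_split_point[OF ncp] in \<open>auto simp: \<phi>_def\<close>)
    moreover have "?c (1, n + m) = p (1, n + 1)"
      using lab[of 1 "n + 1"] False i by (simp add: \<phi>_def)
    ultimately show ?thesis using i by (simp add: arc_value_def \<phi>_def)
  qed
qed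

section \<open>Dependence of arc values on the inputs\<close>

lemma arc_value_cong:
  assumes "noncrossing e n p" "1 \<le> x" "x < y" "y \<le> n + 1"
    and "\<And>j. x \<le> j \<Longrightarrow> j < y \<Longrightarrow> a j = b j"
  shows "arc_value p a x y = arc_value p b x y"
  using assms(2-)
proof (induction "y - x" arbitrary: x y rule: less_induct)
  case less
  show ?case
  proof (cases "y = Suc x")
    case True
    then show ?thesis using less.prems by (simp add: arc_value_edge)
  next
    case False
    then obtain z where z: "split_point e p x y z"
      using noncrossing_split_point[OF assms(1)] less.prems by fastforce
    then show ?thesis
      using less.hyps[of z x] less.hyps[of y z] less.prems split_point_between[OF z]
      by (simp add: arc_value_def[of _ _ x y] inner_value_split)
  qed
qed

text \<open>After a split at \<open>z\<close>, exactly one factor depends on input \<open>k\<close>;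
  the other is constant by \<open>arc_value_cong\<close>.\<close>

lemma arc_value_linear:
  assumes "noncrossing e n p" "1 \<le> x" "y \<le> n + 1" "x \<le> k" "k < y"
  shows "Vector_Spaces.linear scale scale (\<lambda>t. arc_value p (a(k := t)) x y)"
  using assms(2-)
proof (induction "y - x" arbitrary: x y rule: less_induct)
  case less
  have omega_comp: "Vector_Spaces.linear scale scale (\<lambda>t. \<omega> w (f t))"
    if "Vector_Spaces.linear scale scale f" for w f
    using Vector_Spaces.linear_compose[OF that omega_linear] by (simp add: o_def)
  show ?case
  proof (cases "y = Suc x")
    case True
    then show ?thesis using less.prems omega_linear by (simp add: arc_value_edge)
  next
    case False
    then obtain z where z: "split_point e p x y z"
      using noncrossing_split_point[OF assms(1)] less.prems by fastforce
    note zb = split_point_between[OF z]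
    have eq: "arc_value p (a(k := t)) x y =
        \<omega> (p (x, y)) (mul (arc_value p (a(k := t)) x z) (arc_value p (a(k := t)) z y))" for t
      by (simp add: arc_value_def[of _ _ x y] inner_value_split[OF z])
    show ?thesis
    proof (cases "k < z")
      case True
      have "arc_value p (a(k := t)) z y = arc_value p a z y" for t
        using True less.prems zb by (intro arc_value_cong[OF assms(1)]) auto
      moreover have "Vector_Spaces.linear scale scale
          (\<lambda>t. mul (arc_value p (a(k := t)) x z) (arc_value p a z y))"
        using Vector_Spaces.linear_compose[OF less.hyps[of z x] mul_linear_left] True less.prems zb
        by (simp add: o_def)
      ultimately show ?thesis by (simp add: eq omega_comp)
    next
      case False
      have "arc_value p (a(k := t)) x z = arc_value p a x z" for t
        using False less.prems zb by (intro arc_value_cong[OF assms(1)]) auto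
      moreover have "Vector_Spaces.linear scale scale
          (\<lambda>t. mul (arc_value p a x z) (arc_value p (a(k := t)) z y))"
        using Vector_Spaces.linear_compose[OF less.hyps[of y z] mul_linear_right] False less.prems zb
        by (simp add: o_def)
      ultimately show ?thesis by (simp add: eq omega_comp)
    qed
  qed
qed

section \<open>The action of cliques and its linear extension\<close>

text \<open>The \<open>i\<close>th edge \<open>(i, i + 1)\<close> carries the list entry of index \<open>i - 1\<close>.\<close>

definition clique_act :: "nat \<Rightarrow> 'm clique \<Rightarrow> 'a list \<Rightarrow> 'a" where
  "clique_act n p xs = arc_value p (\<lambda>j. xs ! (j - 1)) 1 (n + 1)"

definition NC_act :: "nat \<Rightarrow> ('m clique \<Rightarrow>\<^sub>0 'k) \<Rightarrow> 'a list \<Rightarrow> 'a" where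
  "NC_act n f xs =
     (\<Sum>p \<in> Poly_Mapping.keys f. scale (Poly_Mapping.lookup f p) (clique_act n p xs))"

text \<open>Coefficients outside the support vanish; this allows one index set for several
  combinations.\<close>

lemma NC_act_superset:
  assumes "finite S" "Poly_Mapping.keys f \<subseteq> S"
  shows "NC_act n f xs = (\<Sum>p \<in> S. scale (Poly_Mapping.lookup f p) (clique_act n p xs))"
  unfolding NC_act_def using assms by (intro sum.mono_neutral_left) (auto simp: in_keys_iff)

lemma NC_act_add: "NC_act n (f + g) xs = NC_act n f xs + NC_act n g xs"
proof -
  let ?S = "Poly_Mapping.keys f \<union> Poly_Mapping.keys g"
  have "Poly_Mapping.keys (f + g) \<subseteq> ?S" by (rule Poly_Mapping.keys_add)
  then show ?thesis
    by (simp add: NC_act_superset[of ?S] lookup_add scale_left_distrib sum.distrib)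
qed

lemma NC_act_sum: "NC_act n (\<Sum>x \<in> I. F x) xs = (\<Sum>x \<in> I. NC_act n (F x) xs)"
proof (induction I rule: infinite_finite_induct)
  case (insert x I)
  then show ?case by (simp add: NC_act_add)
qed (simp_all add: NC_act_def)

lemma NC_act_single: "NC_act n (Poly_Mapping.single p c) xs = scale c (clique_act n p xs)"
  by (subst NC_act_superset[of "{p}"]) auto

lemma NC_act_smult: "NC_act n (smult_pm c f) xs = scale c (NC_act n f xs)"
proof -
  \<comment> \<open>\<open>Poly_Mapping.map\<close> acts on nonzero coefficients only, which is
    harmless as \<open>c * 0 = 0\<close>.\<close>
  have lookup: "Poly_Mapping.lookup (smult_pm c f) p = c * Poly_Mapping.lookup f p" for p
    by (simp add: Poly_Mapping.map.rep_eq when_def)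
  then have "Poly_Mapping.keys (smult_pm c f) \<subseteq> Poly_Mapping.keys f"
    by (auto simp: in_keys_iff)
  then show ?thesis
    by (simp add: NC_act_superset[of "Poly_Mapping.keys f"] lookup scale_sum_right)
qed

lemma clique_act_linear:
  assumes p: "p \<in> nc_cliques e n" and k: "length xs = n" "k < n"
  shows "Vector_Spaces.linear scale scale (\<lambda>t. clique_act n p (xs[k := t]))"
proof -
  have nc: "noncrossing e n p" using p by (simp add: nc_cliques_def)
  \<comment> \<open>Entry \<open>k\<close> belongs to edge \<open>Suc k\<close>. At
    \<open>j = 0\<close>, where \<open>j - 1\<close> is again \<open>0\<close>, the two inputs may
    differ, but only \<open>j\<close> from \<open>1\<close> to \<open>n\<close> is read.\<close>
  have "clique_act n p (xs[k := t]) = arc_value p ((\<lambda>j. xs ! (j - 1))(Suc k := t)) 1 (n + 1)" for t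
    unfolding clique_act_def using k
    by (intro arc_value_cong[OF nc]) (auto simp: nth_list_update)
  then show ?thesis using k by (simp add: arc_value_linear[OF nc])
qed

lemma NC_act_linear:
  assumes f: "f \<in> NC e n" and k: "length xs = n" "k < n"
  shows "Vector_Spaces.linear scale scale (\<lambda>t. NC_act n f (xs[k := t]))"
proof -
  interpret vector_space_pair scale scale by unfold_locales
  show ?thesis unfolding NC_act_def
    using f clique_act_linear[OF _ k]
    by (intro linear_compose_sum ballI linear_compose_scale_right) (auto simp: NC_def)
qed

section \<open>Compatibility with partial composition\<close>

lemma clique_act_comp:
  assumes p: "p \<in> nc_cliques e n" and q: "q \<in> nc_cliques e m" and i: "1 \<le> i" "i \<le> n"
    and len: "length us = i - 1" "length vs = m" "length ws = n - i"
  shows "clique_act (n + m - 1) (clique_comp star e n m i p q) (us @ vs @ ws) =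
    clique_act n p (us @ clique_act m q vs # ws)"
proof -
  have m: "1 \<le> m" using q by (auto simp: nc_cliques_def cliques_def)
  have "arc_value (clique_comp star e n m i p q) (\<lambda>j. (us @ vs @ ws) ! (j - 1)) 1 (n + m) =
      arc_value p (\<lambda>j. (us @ clique_act m q vs # ws) ! (j - 1)) 1 (n + 1)"
  proof (rule arc_value_comp[OF p q i])
    fix j assume "1 \<le> j" "j \<le> m"
    then show "(us @ vs @ ws) ! (j + i - 1 - 1) = vs ! (j - 1)"
      using len i by (auto simp: nth_append)
  next
    fix j assume j: "i < j" "j \<le> n"
    \<comment> \<open>Entries of \<open>ws\<close> come after one entry for \<open>q\<close> on the
      side of \<open>p\<close>, but after the \<open>m\<close> entries of \<open>vs\<close> in the
      composite.\<close>
    have "j - 1 - length us = Suc (j - i - 1)" "j + m - 1 - 1 - length us - length vs = j - i - 1"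
      "\<not> j - 1 < length us" "\<not> j + m - 1 - 1 < length us" "\<not> j + m - 1 - 1 - length us < length vs"
      using j len i m by auto
    then show "(us @ clique_act m q vs # ws) ! (j - 1) = (us @ vs @ ws) ! (j + m - 1 - 1)"
      by (simp only: nth_append if_False nth_Cons_Suc)
  qed (use len i in \<open>auto simp: nth_append clique_act_def\<close>)
  then show ?thesis using m by (simp add: clique_act_def)
qed

text \<open>Bilinear extension of \<open>clique_act_comp\<close>: linearity in slot \<open>i\<close>
  pulls the sum over the cliques of \<open>g\<close> out of the action of \<open>p\<close>.\<close>

lemma NC_act_comp:
  assumes f: "f \<in> NC e n" and g: "g \<in> NC e m" and i: "1 \<le> i" "i \<le> n"
    and len: "length us = i - 1" "length vs = m" "length ws = n - i"
  shows "NC_act (n + m - 1) (NC_comp star e n m i f g) (us @ vs @ ws) =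
    NC_act n f (us @ NC_act m g vs # ws)"
proof -
  interpret vector_space_pair scale scale by unfold_locales
  have lin: "clique_act n p (us @ NC_act m g vs # ws) =
      (\<Sum>q \<in> Poly_Mapping.keys g.
        scale (Poly_Mapping.lookup g q) (clique_act n p (us @ clique_act m q vs # ws)))"
    if "p \<in> nc_cliques e n" for p
  proof -
    define F where "F t = clique_act n p (us @ t # ws)" for t
    \<comment> \<open>The entry \<open>0\<close> only holds the place that the update at index
      \<open>i - 1\<close> overwrites.\<close>
    have "Vector_Spaces.linear scale scale (\<lambda>t. clique_act n p ((us @ 0 # ws)[i - 1 := t]))"
      using that i len by (intro clique_act_linear) auto
    then have F: "Vector_Spaces.linear scale scale F"
      using len by (simp add: F_def[abs_def] list_update_append)
    have "F (NC_act m g vs) =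
        (\<Sum>q \<in> Poly_Mapping.keys g. scale (Poly_Mapping.lookup g q) (F (clique_act m q vs)))"
      by (simp add: NC_act_def linear_sum[OF F] linear_scale[OF F])
    then show ?thesis by (simp add: F_def)
  qed
  have "NC_act (n + m - 1) (NC_comp star e n m i f g) (us @ vs @ ws) =
      (\<Sum>p \<in> Poly_Mapping.keys f. \<Sum>q \<in> Poly_Mapping.keys g.
        scale (Poly_Mapping.lookup f p * Poly_Mapping.lookup g q)
          (clique_act n p (us @ clique_act m q vs # ws)))"
    unfolding NC_comp_def NC_act_sum NC_act_single
    using f g
    by (intro sum.cong refl arg_cong[where f = "scale _"] clique_act_comp[OF _ _ i len])
      (auto simp: NC_def)
  also have "\<dots> = NC_act n f (us @ NC_act m g vs # ws)"
    unfolding NC_act_def[of n] using f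
    by (intro sum.cong refl) (auto simp: NC_def lin scale_sum_right)
  finally show ?thesis .
qed

lemma NC_algebra_NC_act: "NC_algebra star e scale NC_act"
  unfolding NC_algebra_def
proof (intro operad_algebra.intro operad_algebra_axioms.intro vector_space_axioms)
  show "NC_act 1 (NC_unit e) [a] = a" for a
    using arc_value_edge[of _ _ 1]
    by (simp add: NC_unit_def NC_act_single clique_act_def omega_unit arcs_def numeral_2_eq_2)
qed (simp_all add: NC_act_add NC_act_smult NC_act_linear NC_act_comp[simplified])

lemma NC_act_triangle:
  "NC_act 2 (Poly_Mapping.single p 1) [a1, a2] =
    \<omega> (base_label 2 p) (mul (\<omega> (edge_label p 1) a1) (\<omega> (edge_label p 2) a2))"
proof -
  \<comment> \<open>The only arc of a triangle over vertex \<open>2\<close> is the base, which is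
    exempt.\<close>
  have "split_point e p 1 3 2" by (auto simp: split_point_def)
  then have "arc_value p a 1 3 =
      \<omega> (p (1, 3)) (mul (\<omega> (p (1, 2)) (a 1)) (\<omega> (p (2, 3)) (a 2)))" for a
    unfolding arc_value_def[of p a 1 3]
    using inner_value_split[of p 1 3 2 a] arc_value_edge[of p a 1] arc_value_edge[of p a 2]
    by (simp add: numeral_2_eq_2 numeral_3_eq_3)
  then show ?thesis
    by (simp add: NC_act_single clique_act_def base_label_def edge_label_def flip: numeral_2_eq_2)
qed

end

theorem theorem3p19:
  fixes star :: "'m::finite \<Rightarrow> 'm \<Rightarrow> 'm" and e :: 'm
    and scale :: "'k::field_char_0 \<Rightarrow> 'a::ab_group_add \<Rightarrow> 'a"
    and mul :: "'a \<Rightarrow> 'a \<Rightarrow> 'a"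
    and \<omega> :: "'m \<Rightarrow> 'a \<Rightarrow> 'a"
  assumes "unitary_magma star e"
    and "associative_algebra scale mul"
    and "\<And>x. Vector_Spaces.linear scale scale (\<omega> x)"
    and "\<omega> e = id"
    and "\<And>x y. \<omega> x \<circ> \<omega> y = \<omega> (star x y)"
  shows "\<exists>act. NC_algebra star e scale act \<and>
    (\<forall>p \<in> cliques e 2. \<forall>a1 a2.
       act 2 (Poly_Mapping.single p 1) [a1, a2] =
         \<omega> (base_label 2 p) (mul (\<omega> (edge_label p 1) a1) (\<omega> (edge_label p 2) a2)))"
proof -
  interpret unitary_magma star e by fact
  interpret associative_algebra scale mul by fact
  interpret magma_module star e scale mul \<omega>
  proof (intro magma_module.intro magma_module_axioms.intro assms(1-3))
    show "\<omega> e a = a" for a by (simp add: assms(4))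
    show "\<omega> (star x y) a = \<omega> x (\<omega> y a)" for x y a
      unfolding assms(5)[symmetric] by (rule comp_apply)
  qed
  show ?thesis
    by (intro exI[of _ NC_act] conjI ballI allI NC_algebra_NC_act NC_act_triangle)
qed

end
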